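(* The image under $\tilde{T}$ of any stepped surface is a stepped surface.
   Context: Fix an integer $d\geq 3$; $(\vec{e}_1,\ldots,\vec{e}_d)$ is the canonical basis of $\mathbb{R}^d$. A stepped function is a function $\mathcal{E}:\mathbb{Z}^d\times\{1,\ldots,d\}\to\mathbb{Z}$ (set $\mathfrak{F}$), compared pointwise by $\leq$; it is binary if it takes only the values $0$ and $1$ (set $\mathfrak{B}$). The face $(\vec{x},i^* )$ is the stepped function with value $1$ at $(\vec{x},i)$ and $0$ elsewhere. The geometric interpretation of $\mathcal{B}\in\mathfrak{B}$ is the union, over all $(\vec{x},i)$ with $\mathcal{B}(\vec{x},i)=1$, of the facets $\{\vec{x}+\vec{e}_i+\sum_{j\neq i}\lambda_j\vec{e}_j \mid 0\leq\lambda_j\leq 1\}$. Let $\pi$ be the orthogonal projection of $\mathbb{R}^d$ onto $\Delta=\{\vec{x} \mid x_1+\cdots+x_d=0\}$. A stepped surface is a binary stepped function whose geometric interpretation is homeomorphic to $\Delta$ under $\pi$ (i.e. the restriction of $\pi$ to it is a homeomorphism onto $\Delta$). Dual maps. $F_d$ is the free group on $\{1,\ldots,d\}$ (elements in reduced form); $\vec{f}:F_d\to\mathbb{Z}^d$ sends $w$ to the vector whose $i$-th entry is the sum of the exponents of $i$ in $w$. The incidence matrix $M_\sigma$ of an endomorphism $\sigma$ of $F_d$ has $i$-th column $\vec{f}(\sigma(i))$; $\sigma$ is unimodular if $\det M_\sigma=\pm1$. The dual map $E_1^*(\sigma):\mathfrak{F}\to\mathfrak{F}$ of a unimodular $\sigma$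 is $$E_1^*(\sigma)(\mathcal{E})(\vec{x},i)=\sum_{\sigma(i)=p\cdot j\cdot s}\mathcal{E}(M_\sigma\vec{x}+\vec{f}(p),j)-\sum_{\sigma(i)=p\cdot j^{-1}\cdot s}\mathcal{E}(M_\sigma\vec{x}+\vec{f}(p)-\vec{e}_j,j),$$ the sums ranging over all occurrences in $\sigma(i)$ of letters $j$ (resp. inverse letters $j^{-1}$), with $p$ the prefix before and $s$ the suffix after the occurrence. The Brun substitution $\beta_{a,i,j}$ ($a\in\mathbb{N}$, $i\neq j$) is the automorphism of $F_d$ with $\beta_{a,i,j}(i)=i^aj$, $\beta_{a,i,j}(j)=i$, $\beta_{a,i,j}(k)=k$ for $k\notin\{i,j\}$; its inverse satisfies $\beta_{a,i,j}^{-1}(i)=j$, $\beta_{a,i,j}^{-1}(j)=j^{-a}i$, $\beta_{a,i,j}^{-1}(k)=k$. Runs. For $i\neq j$ and $\mathcal{B}\in\mathfrak{B}$, an $(\vec{e}_j,i)$-run of $\mathcal{B}$ is a non-zero binary stepped function $\mathcal{R}=\sum_{k\in I}(\vec{x}+k\vec{e}_j,i^* )$, where $\vec{x}\in\mathbb{Z}^d$ and $I$ is maximal among the intervals of $\mathbb{Z}$ such that $\mathcal{R}\leq\mathcal{B}$; its length is $\#I$ (possibly infinite). The map $\tilde{T}:\mathfrak{B}\to\mathfrak{F}$. Let $\mathcal{B}\in\mathfrak{B}$. Suppose there are $i\neq j$ in $\{1,\ldots,d\}$ such that (1) for any $k\neq i$, all $(\vec{e}_i,k)$-runs and (when $k\neq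 j$) all $(\vec{e}_j,k)$-runs of $\mathcal{B}$, if any, have length $1$; (2) $\mathcal{B}$ has at least one finite $(\vec{e}_j,i)$-run. Take the lexicographically smallest such pair $(i,j)$, let $a$ be the length of the shortest $(\vec{e}_j,i)$-run of $\mathcal{B}$, and set $\tilde{T}(\mathcal{B})=E_1^*(\beta_{a,i,j}^{-1})(\mathcal{B})$. If there is no such pair, set $\tilde{T}(\mathcal{B})=\mathcal{B}$. *)

theory Defs
  imports "HOL-Analysis.Analysis" "HOL-Algebra.Group"
begin

text \<open>The index set \<open>{1,...,d}\<close> is a finite linearly ordered type \<open>'n\<close>, with \<open>d = CARD('n)\<close>.\<close>

section \<open>Stepped functions and stepped surfaces\<close>

type_synonym 'n stepped = "(int ^ 'n) \<times> 'n \<Rightarrow> int"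

definition binary :: "'n::finite stepped \<Rightarrow> bool" where
  "binary B \<longleftrightarrow> range B \<subseteq> {0, 1}"

definition facet :: "int ^ 'n \<Rightarrow> 'n::finite \<Rightarrow> (real ^ 'n) set" where
  "facet x i = {(\<chi> k. real_of_int (x $ k)) + axis i 1 + (\<Sum>j\<in>UNIV - {i}. c j *\<^sub>R axis j 1) | c.
     \<forall>j. j \<noteq> i \<longrightarrow> 0 \<le> c j \<and> c j \<le> 1}"

definition geom :: "'n::finite stepped \<Rightarrow> (real ^ 'n) set" where
  "geom B = (\<Union>(x, i) \<in> {f. B f = 1}. facet x i)"

definition diag_plane :: "(real ^ 'n::finite) set" where
  "diag_plane = {x. (\<Sum>i\<in>UNIV. x $ i) = 0}"

definition diag_proj :: "real ^ 'n::finite \<Rightarrow> real ^ 'n" where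
  "diag_proj x = (THE y. y \<in> diag_plane \<and> (\<forall>z\<in>diag_plane. orthogonal (x - y) z))"

lemma diag_proj_eq:
  fixes x :: "real ^ 'n::finite"
  shows "diag_proj x = (\<chi> k. x $ k - (\<Sum>i\<in>UNIV. x $ i) / real CARD('n))"
  unfolding diag_proj_def
proof (rule the_equality)
  let ?p = "(\<chi> k. x $ k - (\<Sum>i\<in>UNIV. x $ i) / real CARD('n)) :: real ^ 'n"
  have p: "?p \<in> diag_plane"
    by (simp add: diag_plane_def sum_subtractf)
  have o: "orthogonal (x - ?p) z" if "z \<in> diag_plane" for z
    using that
    by (simp add: diag_plane_def orthogonal_def inner_vec_def flip: sum_distrib_left sum_divide_distrib)
  show "?p \<in> diag_plane \<and> (\<forall>z\<in>diag_plane. orthogonal (x - ?p) z)"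
    using p o by blast
  fix y :: "real ^ 'n"
  assume y: "y \<in> diag_plane \<and> (\<forall>z\<in>diag_plane. orthogonal (x - y) z)"
  have d: "y - ?p \<in> diag_plane"
    using y p by (simp add: diag_plane_def sum_subtractf)
  have "(x - y) \<bullet> (y - ?p) = 0" "(x - ?p) \<bullet> (y - ?p) = 0"
    using y o[OF d] d by (auto simp: orthogonal_def)
  then have "((x - ?p) - (x - y)) \<bullet> (y - ?p) = 0"
    by (simp only: inner_diff_left diff_self)
  then show "y = ?p"
    by simp
qed

definition stepped_surface :: "'n::finite stepped \<Rightarrow> bool" where
  "stepped_surface B \<longleftrightarrow> binary B \<and> (\<exists>g. homeomorphism (geom B) diag_plane diag_proj g)"


section \<open>The free group\<close>

datatype 'n letter = Pos 'n | Neg 'n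

type_synonym 'n word = "'n letter list"

primrec letter_inv :: "'n letter \<Rightarrow> 'n letter" where
  "letter_inv (Pos i) = Neg i"
| "letter_inv (Neg i) = Pos i"

definition word_inv :: "'n word \<Rightarrow> 'n word" where
  "word_inv w = rev (map letter_inv w)"

definition reduced_word :: "'n word \<Rightarrow> bool" where
  "reduced_word w \<longleftrightarrow> (\<forall>l. Suc l < length w \<longrightarrow> w ! Suc l \<noteq> letter_inv (w ! l))"

fun cons_red :: "'n letter \<Rightarrow> 'n word \<Rightarrow> 'n word" where
  "cons_red x [] = [x]"
| "cons_red x (y # w) = (if y = letter_inv x then w else x # y # w)"

definition reduce :: "'n word \<Rightarrow> 'n word" where
  "reduce w = foldr cons_red w []"

definition free_group :: "'n word monoid" where
  "free_group = \<lparr>carrier = {w. reduced_word w}, mult = (\<lambda>u v. reduce (u @ v)), one = []\<rparr>"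

primrec letter_image :: "('n \<Rightarrow> 'n word) \<Rightarrow> 'n letter \<Rightarrow> 'n word" where
  "letter_image f (Pos i) = f i"
| "letter_image f (Neg i) = word_inv (f i)"

text \<open>The endomorphism of the free group that extends \<open>f\<close> on generators.\<close>
definition free_extend :: "('n \<Rightarrow> 'n word) \<Rightarrow> 'n word \<Rightarrow> 'n word" where
  "free_extend f w = reduce (concat (map (letter_image f) w))"

lemma letter_inv_inv [simp]: "letter_inv (letter_inv x) = x"
  by (cases x) auto

lemma letter_inv_eq_iff: "letter_inv x = y \<longleftrightarrow> x = letter_inv y"
  by auto

lemma letter_inv_neq [simp]: "letter_inv x \<noteq> x" "x \<noteq> letter_inv x"
  by (cases x; simp)+

lemma word_inv_simps [simp]:
  "word_inv [] = []" "word_inv (x # w) = word_inv w @ [letter_inv x]"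
  "word_inv (u @ v) = word_inv v @ word_inv u" "word_inv (word_inv w) = w"
  by (simp_all add: word_inv_def rev_map o_def)

lemma reduced_simps [simp]:
  "reduced_word []" "reduced_word [x]"
  "reduced_word (x # y # w) \<longleftrightarrow> y \<noteq> letter_inv x \<and> reduced_word (y # w)"
  by (auto simp: reduced_word_def nth_Cons split: nat.splits)

lemma reduced_tl: "reduced_word (x # w) \<Longrightarrow> reduced_word w"
  by (cases w) auto

lemma reduced_cons_red: "reduced_word w \<Longrightarrow> reduced_word (cons_red x w)"
  by (cases w) (auto dest: reduced_tl)

lemma reduced_foldr: "reduced_word v \<Longrightarrow> reduced_word (foldr cons_red u v)"
  by (induction u) (auto simp: reduced_cons_red)

lemma reduced_reduce [simp]: "reduced_word (reduce w)"
  by (simp add: reduce_def reduced_foldr)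

lemma reduce_id: "reduced_word w \<Longrightarrow> reduce w = w"
proof (induction w)
  case (Cons x w)
  then show ?case
    by (cases w) (auto simp: reduce_def dest: reduced_tl)
qed (simp add: reduce_def)

lemma cons_red_cancel: "reduced_word w \<Longrightarrow> cons_red x (cons_red (letter_inv x) w) = w"
  by (cases w rule: remdups_adj.cases) auto

lemma foldr_cons_red: 
  "reduced_word v \<Longrightarrow> foldr cons_red (cons_red x u) v = cons_red x (foldr cons_red u v)"
  by (cases u) (auto simp: cons_red_cancel reduced_foldr)

lemma foldr_reduce: "reduced_word v \<Longrightarrow> foldr cons_red (reduce u) v = foldr cons_red u v"
  by (induction u) (auto simp: reduce_def foldr_cons_red)

lemma reduce_append_right [simp]: "reduce (u @ reduce v) = reduce (u @ v)"
  using reduce_id[OF reduced_reduce, of v] by (simp add: reduce_def)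

lemma reduce_append_left [simp]: "reduce (reduce u @ v) = reduce (u @ v)"
  using foldr_reduce[of "reduce v" u] by (simp add: reduce_def reduced_foldr)

lemma reduce_reduce [simp]: "reduce (reduce w) = reduce w"
  by (simp add: reduce_id)

lemma reduce_cancel: "reduce (u @ word_inv u @ v) = reduce v"
proof (induction u arbitrary: v)
  case (Cons x u)
  have "reduce ((x # u) @ word_inv (x # u) @ v) = cons_red x (reduce (u @ word_inv u @ letter_inv x # v))"
    by (simp add: reduce_def)
  also have "\<dots> = cons_red x (cons_red (letter_inv x) (reduce v))"
    by (simp only: Cons.IH) (simp add: reduce_def)
  finally show ?case
    by (simp add: cons_red_cancel)
qed simp

lemma reduced_word_inv: "reduced_word w \<Longrightarrow> reduced_word (word_inv w)"
  unfolding reduced_word_def word_inv_def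
proof (intro allI impI)
  fix l assume *: "\<forall>l. Suc l < length w \<longrightarrow> w ! Suc l \<noteq> letter_inv (w ! l)"
    and l: "Suc l < length (rev (map letter_inv w))"
  define m where "m = length w - Suc (Suc l)"
  have "Suc m < length w" "length w - Suc l = Suc m"
    using l by (auto simp: m_def)
  with * have "w ! Suc m \<noteq> letter_inv (w ! m)" by blast
  then show "rev (map letter_inv w) ! Suc l \<noteq> letter_inv (rev (map letter_inv w) ! l)"
    using l \<open>length w - Suc l = Suc m\<close> by (auto simp: rev_nth m_def)
qed

lemma group_free_group: "group (free_group :: 'n word monoid)"
proof (rule groupI)
  fix x :: "'n word" assume "x \<in> carrier free_group"
  then have "word_inv x \<in> carrier free_group \<and> word_inv x \<otimes>\<^bsub>free_group\<^esub> x = \<one>\<^bsub>free_group\<^esub>"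
    using reduce_cancel[of "word_inv x" "[]"]
    by (simp add: free_group_def reduced_word_inv) (simp add: reduce_def)
  then show "\<exists>y\<in>carrier free_group. y \<otimes>\<^bsub>free_group\<^esub> x = \<one>\<^bsub>free_group\<^esub>"
    by blast
qed (auto simp: free_group_def reduce_id)

lemma letter_image_cancel:
  "reduce (letter_image f x @ letter_image f (letter_inv x) @ v) = reduce v"
proof (cases x)
  case (Neg i)
  then show ?thesis
    using reduce_cancel[of "word_inv (f i)" v] by simp
qed (simp add: reduce_cancel)

lemma free_extend_append: "free_extend f (u @ v) = reduce (free_extend f u @ free_extend f v)"
  by (simp add: free_extend_def)

lemma free_extend_cons_red:
  "free_extend f (cons_red x w) = reduce (letter_image f x @ free_extend f w)"
proof (cases w)
  case (Cons y v)
  then show ?thesis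
    by (simp add: free_extend_def letter_image_cancel)
qed (simp add: free_extend_def)

lemma free_extend_reduce: "free_extend f (reduce w) = free_extend f w"
proof (induction w)
  case (Cons x w)
  have "free_extend f (reduce (x # w)) = free_extend f (cons_red x (reduce w))"
    by (simp add: reduce_def)
  then show ?case
    by (simp only: free_extend_cons_red Cons.IH) (simp add: free_extend_def)
qed (simp add: reduce_def)

lemma free_extend_hom: "free_extend f \<in> hom free_group free_group"
  by (rule homI) (simp_all add: free_group_def free_extend_reduce free_extend_append,
      simp_all add: free_extend_def)

lemma free_extend_Pos: "free_extend f [Pos i] = reduce (f i)"
  by (simp add: free_extend_def)

lemma reduce_word_inv: "reduce (word_inv (reduce w)) = reduce (word_inv w)"
proof -
  have "reduce (word_inv (reduce w)) = reduce (word_inv (reduce w) @ w @ word_inv w)"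
    using reduce_cancel[of w "[]"] reduce_append_right[of "word_inv (reduce w)" "w @ word_inv w"]
    by simp
  also have "\<dots> = reduce (word_inv (reduce w) @ reduce w @ word_inv w)"
    using reduce_append_right[of "word_inv (reduce w)" "w @ word_inv w"]
      reduce_append_right[of "word_inv (reduce w)" "reduce w @ word_inv w"]
    by simp
  also have "\<dots> = reduce (word_inv w)"
    using reduce_cancel[of "word_inv (reduce w)" "word_inv w"] by simp
  finally show ?thesis .
qed

lemma free_extend_word_inv: "free_extend f (word_inv w) = reduce (word_inv (free_extend f w))"
proof -
  have "concat (map (letter_image f) (word_inv w)) = word_inv (concat (map (letter_image f) w))"
  proof (induction w)
    case (Cons x w)
    then show ?case by (cases x) auto
  qed simp
  then show ?thesis
    by (simp add: free_extend_def reduce_word_inv)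
qed

lemma free_extend_comp:
  "free_extend f (free_extend g w) = free_extend (\<lambda>i. free_extend f (g i)) w"
proof (induction w)
  case (Cons x w)
  have "free_extend f (letter_image g x) = reduce (letter_image (\<lambda>i. free_extend f (g i)) x)"
    by (cases x) (auto simp: free_extend_word_inv, simp add: free_extend_def)
  moreover have "free_extend h (x # w) = reduce (letter_image h x @ free_extend h w)" for h :: "'a \<Rightarrow> 'a word"
    by (simp add: free_extend_def)
  ultimately show ?case
    by (simp add: free_extend_reduce free_extend_append Cons.IH)
qed (simp add: free_extend_def reduce_def)

lemma free_extend_id: "reduced_word w \<Longrightarrow> free_extend (\<lambda>i. [Pos i]) w = w"
proof -
  assume w: "reduced_word w"
  have "letter_image (\<lambda>i. [Pos i]) x = [x]" for x :: "'a letter"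
    by (cases x) auto
  then have "letter_image (\<lambda>i. [Pos i]) = (\<lambda>x :: 'a letter. [x])"
    by blast
  then show ?thesis
    using w by (simp add: free_extend_def reduce_id)
qed


section \<open>Dual maps\<close>

definition exp_vec :: "'n::finite word \<Rightarrow> int ^ 'n" where
  "exp_vec w = (\<chi> i. int (count_list w (Pos i)) - int (count_list w (Neg i)))"

definition incidence_matrix :: "('n::finite word \<Rightarrow> 'n word) \<Rightarrow> int ^ 'n ^ 'n" where
  "incidence_matrix \<sigma> = (\<chi> r c. exp_vec (\<sigma> [Pos c]) $ r)"

definition unimodular :: "('n::finite word \<Rightarrow> 'n word) \<Rightarrow> bool" where
  "unimodular \<sigma> \<longleftrightarrow> \<sigma> \<in> hom free_group free_group \<and> \<bar>det (incidence_matrix \<sigma>)\<bar> = 1"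

text \<open>The summation index \<open>l\<close> is the position of the occurrence in \<open>\<sigma>(i)\<close>, so the prefix is
  \<open>take l (\<sigma> [Pos i])\<close>. The formula is meant for unimodular \<open>\<sigma>\<close>.\<close>
definition dual_map :: "('n::finite word \<Rightarrow> 'n word) \<Rightarrow> 'n stepped \<Rightarrow> 'n stepped" where
  "dual_map \<sigma> E = (\<lambda>(x, i). \<Sum>l<length (\<sigma> [Pos i]).
     let y = incidence_matrix \<sigma> *v x + exp_vec (take l (\<sigma> [Pos i])) in
     case \<sigma> [Pos i] ! l of
       Pos j \<Rightarrow> E (y, j)
     | Neg j \<Rightarrow> - E (y - axis j 1, j))"

lemma exp_vec_simps [simp]:
  "exp_vec [] = 0"
  "exp_vec (Pos i # w) = axis i 1 + exp_vec w"
  "exp_vec (Neg i # w) = - axis i 1 + exp_vec w"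
  by (auto simp: exp_vec_def vec_eq_iff axis_def)

lemma exp_vec_append [simp]: "exp_vec (u @ v) = exp_vec u + exp_vec v"
  by (simp add: exp_vec_def vec_eq_iff)

lemma exp_vec_word_inv [simp]: "exp_vec (word_inv w) = - exp_vec w"
proof (induction w)
  case (Cons x w)
  then show ?case by (cases x) auto
qed simp

lemma exp_vec_reduce [simp]: "exp_vec (reduce w) = exp_vec w"
proof (induction w)
  case (Cons x w)
  have "exp_vec (cons_red x v) = exp_vec (x # v)" for v
    by (cases v; cases x) auto
  moreover have "reduce (x # w) = cons_red x (reduce w)"
    by (simp add: reduce_def)
  ultimately show ?case
    using Cons.IH by (cases x) auto
qed (simp add: reduce_def)

lemma exp_vec_free_extend:
  "exp_vec (free_extend f w) = incidence_matrix (free_extend f) *v exp_vec w"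
proof (induction w)
  case Nil
  then show ?case by (simp add: free_extend_def reduce_def)
next
  case (Cons x w)
  have gen: "incidence_matrix (free_extend f) *v axis i 1 = exp_vec (f i)" for i
    by (auto simp: incidence_matrix_def matrix_vector_mult_def vec_eq_iff axis_def
        free_extend_Pos if_distrib cong: if_cong)
  have "exp_vec (free_extend f (x # w)) = exp_vec (letter_image f x) + exp_vec (free_extend f w)"
    by (simp add: free_extend_def)
  moreover have "A *v (u - v) = A *v u - A *v v" for A :: "int ^ 'a ^ 'a" and u v
    by (simp add: matrix_vector_mult_def vec_eq_iff right_diff_distrib sum_subtractf)
  ultimately show ?case
    by (cases x) (auto simp: Cons.IH gen matrix_vector_right_distrib)
qed


section \<open>Brun substitutions\<close>

definition brun :: "nat \<Rightarrow> 'n \<Rightarrow> 'n \<Rightarrow> 'n word \<Rightarrow> 'n word" where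
  "brun a i j = free_extend (\<lambda>k.
     if k = i then replicate a (Pos i) @ [Pos j] else if k = j then [Pos i] else [Pos k])"

definition brun_inv :: "nat \<Rightarrow> 'n \<Rightarrow> 'n \<Rightarrow> 'n word \<Rightarrow> 'n word" where
  "brun_inv a i j = inv_into (carrier free_group) (brun a i j)"

definition brun_inv_gen :: "nat \<Rightarrow> 'n \<Rightarrow> 'n \<Rightarrow> 'n \<Rightarrow> 'n word" where
  "brun_inv_gen a i j k =
     (if k = i then [Pos j] else if k = j then replicate a (Neg j) @ [Pos i] else [Pos k])"

lemma word_inv_replicate: "word_inv (replicate a x) = replicate a (letter_inv x)"
  by (simp add: word_inv_def)

lemma concat_replicate_single: "concat (replicate a [x]) = replicate a x"
  by (induction a) auto

lemma brun_brun_inv_gen: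
  assumes "i \<noteq> j" "reduced_word w"
  shows "brun a i j (free_extend (brun_inv_gen a i j) w) = w"
    and "free_extend (brun_inv_gen a i j) (brun a i j w) = w"
proof -
  note gen = free_extend_def brun_inv_gen_def concat_replicate_single
  have 1: "reduce (replicate a (Neg i) @ replicate a (Pos i) @ [Pos j]) = [Pos j]"
    using reduce_cancel[of "replicate a (Neg i)" "[Pos j]"]
    by (simp add: word_inv_replicate reduce_id)
  have 2: "reduce (replicate a (Pos j) @ replicate a (Neg j) @ [Pos i]) = [Pos i]"
    using reduce_cancel[of "replicate a (Pos j)" "[Pos i]"]
    by (simp add: word_inv_replicate reduce_id)
  let ?f = "\<lambda>k. if k = i then replicate a (Pos i) @ [Pos j] else if k = j then [Pos i] else [Pos k]"
  have "(\<lambda>k. free_extend ?f (brun_inv_gen a i j k)) = (\<lambda>k. [Pos k])"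
    using assms(1) 1 by (auto simp: fun_eq_iff gen reduce_id)
  then show "brun a i j (free_extend (brun_inv_gen a i j) w) = w"
    using assms(2) by (simp add: brun_def free_extend_comp free_extend_id)
  have "(\<lambda>k. free_extend (brun_inv_gen a i j) (?f k)) = (\<lambda>k. [Pos k])"
    using assms(1) 2 by (auto simp: fun_eq_iff gen reduce_id)
  then show "free_extend (brun_inv_gen a i j) (brun a i j w) = w"
    using assms(2) by (simp add: brun_def free_extend_comp free_extend_id)
qed

lemma free_extend_reduced: "reduced_word (free_extend f w)"
  by (simp add: free_extend_def)

lemma brun_iso:
  assumes "i \<noteq> j"
  shows "brun a i j \<in> iso free_group free_group"
proof -
  have "bij_betw (brun a i j) (carrier free_group) (carrier free_group)"
    by (rule bij_betw_byWitness[where f' = "free_extend (brun_inv_gen a i j)"])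
      (auto simp: free_group_def brun_brun_inv_gen assms free_extend_reduced, simp add: brun_def free_extend_reduced)
  then show ?thesis
    by (simp add: iso_def brun_def free_extend_hom)
qed

lemma brun_inv_eq:
  assumes "i \<noteq> j" "reduced_word w"
  shows "brun_inv a i j w = free_extend (brun_inv_gen a i j) w"
  unfolding brun_inv_def
proof (rule inv_into_f_eq)
  show "inj_on (brun a i j) (carrier free_group)"
    using brun_iso[OF assms(1), of a] by (simp add: iso_def bij_betw_def)
qed (use assms in \<open>auto simp: free_group_def free_extend_reduced brun_brun_inv_gen\<close>)

lemma brun_inv_Pos:
  assumes "i \<noteq> j"
  shows "brun_inv a i j [Pos k] =
    (if k = i then [Pos j] else if k = j then replicate a (Neg j) @ [Pos i] else [Pos k])"
proof -
  have "reduced_word (replicate a (Neg j) @ [Pos i])"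
    using assms by (auto simp: reduced_word_def nth_append nth_Cons split: nat.splits)
  then show ?thesis
    using assms by (simp add: brun_inv_eq free_extend_Pos brun_inv_gen_def reduce_id)
qed

lemma brun_inv_unimodular:
  assumes "i \<noteq> j"
  shows "unimodular (brun_inv a i j)"
proof -
  let ?g = "free_extend (brun_inv_gen a i j)"
  have h: "brun_inv a i j \<in> hom free_group free_group"
    unfolding brun_inv_def using group.iso_set_sym[OF group_free_group brun_iso[OF assms, of a]]
    by (simp add: iso_def)
  have "incidence_matrix (brun a i j) *v (incidence_matrix ?g *v axis c 1) = axis c 1" for c
  proof -
    have "exp_vec (brun a i j (?g [Pos c])) = exp_vec [Pos c]"
      using brun_brun_inv_gen(1)[OF assms, of "[Pos c]" a] by simp
    then show ?thesis
      by (simp only: brun_def exp_vec_free_extend) simp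
  qed
  then have "((incidence_matrix (brun a i j) ** incidence_matrix ?g) *v axis c 1) $ r
      = (axis c 1 :: int ^ 'a) $ r" for r c
    by (simp add: matrix_vector_mul_assoc)
  moreover have "(A *v axis c 1) $ r = A $ r $ c" for A :: "int ^ 'a ^ 'a" and r c
    by (auto simp: matrix_vector_mult_def axis_def if_distrib cong: if_cong)
  ultimately have "incidence_matrix (brun a i j) ** incidence_matrix ?g = mat 1"
    by (auto simp: vec_eq_iff mat_def axis_def)
  then have "det (incidence_matrix (brun a i j)) * det (incidence_matrix ?g) = 1"
    by (metis det_I det_mul)
  then have "\<bar>det (incidence_matrix ?g)\<bar> = 1"
    by (metis dvd_triv_right zdvd1_eq)
  moreover have "incidence_matrix (brun_inv a i j) = incidence_matrix ?g"
    by (simp add: incidence_matrix_def brun_inv_eq[OF assms])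
  ultimately show ?thesis
    using h by (simp add: unimodular_def)
qed


section \<open>Runs and the map on binary stepped functions\<close>

definition int_interval :: "int set \<Rightarrow> bool" where
  "int_interval I \<longleftrightarrow> (\<forall>a\<in>I. \<forall>b\<in>I. {a..b} \<subseteq> I)"

text \<open>The pointwise, possibly infinite, sum of the faces \<open>(x + k e\<^sub>j, i\<^sup>*)\<close> over \<open>k \<in> I\<close>;
  these faces are pairwise distinct.\<close>
definition face_row :: "'n \<Rightarrow> 'n::finite \<Rightarrow> int ^ 'n \<Rightarrow> int set \<Rightarrow> 'n stepped" where
  "face_row j i x I = (\<lambda>f. if \<exists>k\<in>I. f = (x + k *s axis j 1, i) then 1 else 0)"

text \<open>\<open>is_run B j i x I\<close>: the function \<open>face_row j i x I\<close> is an \<open>(e\<^sub>j, i)\<close>-run of \<open>B\<close>; its length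
  is the cardinality of \<open>I\<close>, where \<open>I\<close> may be infinite.\<close>
definition is_run :: "'n::finite stepped \<Rightarrow> 'n \<Rightarrow> 'n \<Rightarrow> int ^ 'n \<Rightarrow> int set \<Rightarrow> bool" where
  "is_run B j i x I \<longleftrightarrow> i \<noteq> j \<and> int_interval I \<and> face_row j i x I \<noteq> (\<lambda>_. 0) \<and> face_row j i x I \<le> B \<and>
     (\<forall>I'. int_interval I' \<and> I \<subseteq> I' \<and> face_row j i x I' \<le> B \<longrightarrow> I' = I)"

definition brun_pair :: "'n::finite stepped \<Rightarrow> 'n \<Rightarrow> 'n \<Rightarrow> bool" where
  "brun_pair B i j \<longleftrightarrow> i \<noteq> j \<and>
     (\<forall>k. k \<noteq> i \<longrightarrow>
        (\<forall>x I. is_run B i k x I \<longrightarrow> card I = 1) \<and>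
        (k \<noteq> j \<longrightarrow> (\<forall>x I. is_run B j k x I \<longrightarrow> card I = 1))) \<and>
     (\<exists>x I. is_run B j i x I \<and> finite I)"

definition shortest_run :: "'n::finite stepped \<Rightarrow> 'n \<Rightarrow> 'n \<Rightarrow> nat" where
  "shortest_run B j i = (LEAST n. \<exists>x I. is_run B j i x I \<and> finite I \<and> card I = n)"

definition T_tilde :: "'n::{finite,linorder} stepped \<Rightarrow> 'n stepped" where
  "T_tilde B =
     (if \<exists>i j. brun_pair B i j then
        let i = (LEAST i. \<exists>j. brun_pair B i j);
            j = (LEAST j. brun_pair B i j);
            a = shortest_run B j i
        in dual_map (brun_inv a i j) B
      else B)"

end

theory Submission
  imports Defs
begin

text \<open>A stepped surface is the upper boundary of the union of the unit cubes whose lower corners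
  range over a down-closed set \<open>D\<close> of integer vectors with \<open>D \<noteq> {}\<close> and \<open>D \<noteq> UNIV\<close>: the face
  \<open>(x, i)\<close> is present iff \<open>x \<in> D\<close> and \<open>x + e\<^sub>i \<notin> D\<close>, so the stepped function is the coboundary
  of the indicator of \<open>D\<close>. A dual map sends the coboundary of \<open>h\<close> to the coboundary of
  \<open>h \<circ> M\<close>, because the sum that defines it telescopes along the word. Hence only the
  down-closedness of the preimage of \<open>D\<close> under the incidence matrix of the inverse Brun substitution
  has to be checked, that is, \<open>z + e\<^sub>i \<in> D\<close> implies \<open>z + a e\<^sub>j \<in> D\<close>. A counterexample gives an
  \<open>(e\<^sub>i, j)\<close>-run of length greater than 1 or an \<open>(e\<^sub>j, i)\<close>-run of length smaller than \<open>a\<close>.\<close>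

section \<open>Coboundaries and down-closed sets\<close>

definition coboundary :: "(int ^ 'n::finite \<Rightarrow> int) \<Rightarrow> 'n stepped" where
  "coboundary h = (\<lambda>(x, i). h x - h (x + axis i 1))"

definition down_closed :: "(int ^ 'n::finite) set \<Rightarrow> bool" where
  "down_closed D \<longleftrightarrow> (\<forall>x k. x + axis k 1 \<in> D \<longrightarrow> x \<in> D)"

text \<open>Induction on the sum of the coordinate differences: \<open>y\<close> is lowered by one
  in a coordinate where it still exceeds \<open>x\<close>.\<close>

lemma down_closed_le:
  fixes x y :: "int ^ 'n::finite"
  assumes "down_closed D" "y \<in> D" "\<And>k. x $ k \<le> y $ k"
  shows "x \<in> D"
  using assms(2,3)
proof (induction "nat (\<Sum>k\<in>UNIV. y $ k - x $ k)" arbitrary: y rule: less_induct)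
  case less
  show ?case
  proof (cases "x = y")
    case False
    then obtain k where k: "x $ k < y $ k"
      using less.prems(2) by (metis order_le_less vec_eq_iff)
    define z where "z = y - axis k 1"
    have le: "x $ l \<le> z $ l" for l
      using less.prems(2)[of l] k by (auto simp: z_def axis_def)
    have "z \<in> D"
      using assms(1) less.prems(1) unfolding down_closed_def z_def by (metis diff_add_cancel)
    moreover have "(\<Sum>l\<in>UNIV. z $ l - x $ l) < (\<Sum>l\<in>UNIV. y $ l - x $ l)"
      by (rule sum_strict_mono_ex1) (auto simp: z_def axis_def intro!: exI[of _ k])
    moreover have "(\<Sum>l\<in>UNIV. z $ l - x $ l) \<ge> 0"
      using le by (simp add: sum_nonneg)
    ultimately have "nat (\<Sum>l\<in>UNIV. z $ l - x $ l) < nat (\<Sum>l\<in>UNIV. y $ l - x $ l)"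
      by linarith
    then show ?thesis
      using less.hyps[of z] \<open>z \<in> D\<close> le by blast
  qed (use less.prems in simp)
qed

lemma coboundary_down_closed:
  assumes "down_closed D"
  shows "coboundary (\<lambda>x. of_bool (x \<in> D)) (x, i) = of_bool (x \<in> D \<and> x + axis i 1 \<notin> D)"
  using assms by (auto simp: coboundary_def down_closed_def)

section \<open>Incidence matrices and dual maps of coboundaries\<close>

lemma matrix_vector_mult_axis_int:
  fixes A :: "int ^ 'n::finite ^ 'n"
  shows "A *v axis c 1 = (\<chi> r. A $ r $ c)"
  by (auto simp: matrix_vector_mult_def axis_def vec_eq_iff if_distrib cong: if_cong)

lemma matrix_vector_mult_smult_int:
  fixes A :: "int ^ 'n::finite ^ 'n"
  shows "A *v (c *s u) = c *s (A *v u)"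
  by (simp add: matrix_vector_mult_def vec_eq_iff sum_distrib_left mult.left_commute)

lemma incidence_matrix_axis: "incidence_matrix \<sigma> *v axis i 1 = exp_vec (\<sigma> [Pos i])"
  by (simp add: matrix_vector_mult_axis_int incidence_matrix_def vec_eq_iff)

text \<open>Reading \<open>w\<close> as a lattice path from \<open>y\<close>, every letter
  contributes \<open>h\<close> before its step minus \<open>h\<close> after it. For an inverse
  letter the edge is attached to its lower end \<open>z - axis j 1\<close>, where the step arrives,
  and the minus sign restores the orientation.\<close>

lemma telescope_word:
  "(\<Sum>l<length w. let z = y + exp_vec (take l w) in
     case w ! l of Pos j \<Rightarrow> coboundary h (z, j) | Neg j \<Rightarrow> - coboundary h (z - axis j 1, j))
   = h y - h (y + exp_vec w)"
proof (induction w rule: rev_induct)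
  case (snoc x w)
  have "(\<Sum>l<length w. let z = y + exp_vec (take l (w @ [x])) in
     case (w @ [x]) ! l of Pos j \<Rightarrow> coboundary h (z, j) | Neg j \<Rightarrow> - coboundary h (z - axis j 1, j))
   = h y - h (y + exp_vec w)"
    unfolding snoc.IH[symmetric] by (rule sum.cong) (auto simp: nth_append)
  then show ?case
    by (cases x) (simp_all add: coboundary_def Let_def algebra_simps)
qed simp

text \<open>The path of the word \<open>\<sigma> [Pos i]\<close> leads from the image of
  \<open>x\<close> to the image of \<open>x + axis i 1\<close>, since column \<open>i\<close> of the
  incidence matrix is the abelianization of that word.\<close>

lemma dual_map_coboundary:
  "dual_map \<sigma> (coboundary h) = coboundary (\<lambda>x. h (incidence_matrix \<sigma> *v x))"
proof (rule ext, clarify)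
  fix x i
  show "dual_map \<sigma> (coboundary h) (x, i) = coboundary (\<lambda>x. h (incidence_matrix \<sigma> *v x)) (x, i)"
    unfolding dual_map_def prod.case telescope_word
    by (simp add: coboundary_def matrix_vector_right_distrib incidence_matrix_axis)
qed

section \<open>Stepped surfaces are coboundaries of down-closed sets\<close>

lemma facet_iff:
  "s \<in> facet x i \<longleftrightarrow> s $ i = of_int (x $ i) + 1 \<and>
     (\<forall>k. k \<noteq> i \<longrightarrow> of_int (x $ k) \<le> s $ k \<and> s $ k \<le> of_int (x $ k) + 1)"
proof -
  have sum: "(\<Sum>j\<in>UNIV - {i}. c j *\<^sub>R axis j (1::real)) $ k = (if k = i then 0 else c k)" for c k
    by (auto simp: axis_def if_distrib cong: if_cong)
  show ?thesis
  proof
    assume "s \<in> facet x i"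
    then show "s $ i = of_int (x $ i) + 1 \<and>
       (\<forall>k. k \<noteq> i \<longrightarrow> of_int (x $ k) \<le> s $ k \<and> s $ k \<le> of_int (x $ k) + 1)"
      unfolding facet_def by (auto simp: sum simp del: sum_component) (auto simp: axis_def)
  next
    assume *: "s $ i = of_int (x $ i) + 1 \<and>
       (\<forall>k. k \<noteq> i \<longrightarrow> of_int (x $ k) \<le> s $ k \<and> s $ k \<le> of_int (x $ k) + 1)"
    show "s \<in> facet x i"
      unfolding facet_def mem_Collect_eq
    proof (intro exI[of _ "\<lambda>j. s $ j - of_int (x $ j)"] conjI)
      show "s = (\<chi> k. real_of_int (x $ k)) + axis i 1 +
          (\<Sum>j\<in>UNIV - {i}. (s $ j - of_int (x $ j)) *\<^sub>R axis j 1)"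
        using * by (simp only: vec_eq_iff vector_add_component sum) (auto simp: axis_def)
    qed (use * in \<open>auto simp: algebra_simps\<close>)
  qed
qed

lemma geom_iff: "s \<in> geom B \<longleftrightarrow> (\<exists>x i. B (x, i) = 1 \<and> s \<in> facet x i)"
  by (auto simp: geom_def)

text \<open>Coordinate along the diagonal, scaled so that the all-ones vector \<open>1\<close> has
  height one: \<open>s = diag_proj s + height s *\<^sub>R 1\<close>.\<close>

definition height :: "real ^ 'n::finite \<Rightarrow> real" where
  "height s = (\<Sum>i\<in>UNIV. s $ i) / real CARD('n)"

lemma diag_proj_height: "diag_proj s = s - height s *\<^sub>R 1"
  by (simp add: diag_proj_eq height_def vec_eq_iff)

lemma height_add_diag: "height (s + t *\<^sub>R 1) = height s + t"
  by (simp add: height_def sum.distrib add_divide_distrib)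

lemma height_diag_plane: "p \<in> diag_plane \<Longrightarrow> height p = 0"
  by (simp add: height_def diag_plane_def)

lemma diag_proj_add_diag: "diag_proj (s + t *\<^sub>R 1) = diag_proj s"
  by (simp add: diag_proj_height height_add_diag algebra_simps)

lemma diag_proj_in: "diag_proj s \<in> diag_plane"
  by (simp add: diag_proj_eq diag_plane_def sum_subtractf)

lemma continuous_on_height [continuous_intros]:
  "continuous_on S f \<Longrightarrow> continuous_on S (\<lambda>x. height (f x))"
  unfolding height_def by (intro continuous_intros) auto

lemma continuous_on_diag_proj: "continuous_on S diag_proj"
  by (subst continuous_on_cong[OF refl diag_proj_height]) (intro continuous_intros)

text \<open>The surface splits space into the points below and above it along the diagonal. No open
  unit cube meets it, so each cube lies on one side, and \<open>D\<close> collects the cubes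
  below.\<close>

lemma stepped_surface_imp_coboundary:
  fixes B :: "'n::finite stepped"
  assumes "stepped_surface B"
  obtains D where "down_closed D" "D \<noteq> {}" "D \<noteq> UNIV" "B = coboundary (\<lambda>x. of_bool (x \<in> D))"
proof -
  from assms obtain g where bin: "binary B" and g: "homeomorphism (geom B) diag_plane diag_proj g"
    by (auto simp: stepped_surface_def)
  \<comment> \<open>Signed height of \<open>s\<close> above the surface point on the same diagonal
    line.\<close>
  define \<phi> where "\<phi> s = height s - height (g (diag_proj s))" for s
  have "continuous_on UNIV (\<lambda>s. g (diag_proj s))"
    using g by (intro continuous_on_compose2[OF _ continuous_on_diag_proj])
      (auto simp: homeomorphism_def diag_proj_in)
  then have cont: "continuous_on S \<phi>" for S
    unfolding \<phi>_def by (intro continuous_intros) (rule continuous_on_subset, auto)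
  have zero: "\<phi> s = 0 \<longleftrightarrow> s \<in> geom B" for s
  proof
    assume "\<phi> s = 0"
    moreover have "diag_proj (g (diag_proj s)) = diag_proj s" "g (diag_proj s) \<in> geom B"
      using g diag_proj_in unfolding homeomorphism_def by (metis, metis imageI)
    ultimately show "s \<in> geom B"
      by (simp add: \<phi>_def diag_proj_height)
  next
    assume "s \<in> geom B"
    then show "\<phi> s = 0"
      using g by (simp add: \<phi>_def homeomorphism_def)
  qed
  have shift: "\<phi> (s + t *\<^sub>R 1) = \<phi> s + t" for s t
    by (simp add: \<phi>_def diag_proj_add_diag height_add_diag)
  \<comment> \<open>Intermediate value theorem: on a segment that misses the surface,
    \<open>\<phi>\<close> has no zero and cannot change sign.\<close>
  have sign: "\<phi> u < 0 \<longleftrightarrow> \<phi> v < 0" if "\<And>w. w \<in> closed_segment u v \<Longrightarrow> w \<notin> geom B" for u v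
  proof -
    have conn: "connected (\<phi> ` closed_segment u v)"
      by (intro connected_continuous_image cont) simp
    have "0 \<notin> \<phi> ` closed_segment u v"
      using that zero by (metis imageE)
    then show ?thesis
      using connectedD_interval[OF conn, of "\<phi> u" "\<phi> v" 0] connectedD_interval[OF conn, of "\<phi> v" "\<phi> u" 0]
      by fastforce
  qed
  define cen :: "int ^ 'n \<Rightarrow> real ^ 'n" where "cen x = (\<chi> k. of_int (x $ k) + 1 / 2)" for x
  define D where "D = {x. \<phi> (cen x) < 0}"
  \<comment> \<open>Every point of a facet has an integer coordinate, so the segment from
    \<open>u\<close> to the centre, inside the open cube, misses the surface.\<close>
  have cen_side: "\<phi> u < 0 \<longleftrightarrow> x \<in> D"
    if u: "\<And>k. of_int (x $ k) < u $ k \<and> u $ k < of_int (x $ k) + 1" for u x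
  proof -
    have "w \<notin> geom B" if "w \<in> closed_segment u (cen x)" for w
    proof
      assume "w \<in> geom B"
      then obtain y m where "w $ m = of_int (y $ m) + 1"
        by (auto simp: geom_iff facet_iff)
      moreover have "w $ m \<in> closed_segment (u $ m) (cen x $ m)"
        using that by (auto simp: closed_segment_def)
      then have "of_int (x $ m) < w $ m \<and> w $ m < of_int (x $ m) + 1"
        using u[of m] by (auto simp: closed_segment_eq_real_ivl cen_def split: if_splits)
      ultimately have "x $ m < y $ m + 1" "y $ m < x $ m"
        by linarith+
      then show False by linarith
    qed
    then show ?thesis
      using sign by (simp add: D_def)
  qed
  have B1: "x \<in> D \<and> x + axis i 1 \<notin> D" if "B (x, i) = 1" for x i
  proof -
    \<comment> \<open>The centre of the facet. A quarter step down the diagonal enters the open cube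
      at \<open>x\<close>, a quarter step up the one at \<open>x + axis i 1\<close>.\<close>
    define c where "c = cen x + (1 / 2) *\<^sub>R axis i 1"
    have "c \<in> geom B"
      using that unfolding geom_iff by (intro exI conjI, assumption) (auto simp: facet_iff c_def cen_def axis_def)
    then have "\<phi> c = 0" by (simp add: zero)
    then have "\<phi> (c + (- 1 / 4) *\<^sub>R 1) < 0" "\<not> \<phi> (c + (1 / 4) *\<^sub>R 1) < 0"
      unfolding shift by auto
    moreover have "\<phi> (c + (- 1 / 4) *\<^sub>R 1) < 0 \<longleftrightarrow> x \<in> D"
      by (rule cen_side) (auto simp: c_def cen_def axis_def)
    moreover have "\<phi> (c + (1 / 4) *\<^sub>R 1) < 0 \<longleftrightarrow> x + axis i 1 \<in> D"
      by (rule cen_side) (auto simp: c_def cen_def axis_def)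
    ultimately show ?thesis by blast
  qed
  \<comment> \<open>Along the segment between the two centres all coordinates other than
    \<open>i\<close> are half-integers, so the only facet that it can meet is
    \<open>facet x i\<close>.\<close>
  have B0: "x \<in> D \<longleftrightarrow> x + axis i 1 \<in> D" if "B (x, i) \<noteq> 1" for x i
    unfolding D_def mem_Collect_eq
  proof (rule sign, rule notI)
    fix w assume w: "w \<in> closed_segment (cen x) (cen (x + axis i 1))" and "w \<in> geom B"
    then obtain y m where y: "B (y, m) = 1" "w \<in> facet y m"
      by (auto simp: geom_iff)
    have seg: "w $ k \<in> closed_segment (cen x $ k) (cen (x + axis i 1) $ k)" for k
      using w by (auto simp: closed_segment_def)
    have wk: "w $ k = of_int (x $ k) + 1 / 2" if "k \<noteq> i" for k
      using seg[of k] that by (simp add: cen_def axis_def)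
    have wi: "of_int (x $ i) + 1 / 2 \<le> w $ i" "w $ i \<le> of_int (x $ i) + 3 / 2"
      using seg[of i] by (auto simp: cen_def axis_def closed_segment_eq_real_ivl split: if_splits)
    have wm: "w $ m = of_int (y $ m) + 1"
      using y by (simp add: facet_iff)
    have m: "m = i"
    proof (rule ccontr)
      assume "m \<noteq> i"
      with wk wm have "2 * x $ m + 1 = 2 * (y $ m + 1)"
        by (smt (verit) field_sum_of_halves of_int_1 of_int_add of_int_eq_iff)
      then show False by presburger
    qed
    have "y $ k = x $ k" for k
    proof (cases "k = i")
      case True
      have "x $ i < y $ i + 1" "y $ i < x $ i + 1" using wm[unfolded m] wi by linarith+
      then show ?thesis using True by simp
    next
      case False
      then show ?thesis
        using y(2) wk[of k] m by (auto simp: facet_iff dest!: spec[of _ k])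
    qed
    then have "y = x" by (simp add: vec_eq_iff)
    then show False using y m that by simp
  qed
  have down: "down_closed D"
    unfolding down_closed_def using B0 B1 by blast
  have B01: "B (x, i) = 0 \<or> B (x, i) = 1" for x i
    using bin by (auto simp: binary_def)
  have eq: "B = coboundary (\<lambda>x. of_bool (x \<in> D))"
  proof (rule ext, clarify)
    fix x i
    show "B (x, i) = coboundary (\<lambda>x. of_bool (x \<in> D)) (x, i)"
      unfolding coboundary_down_closed[OF down] using B01[of x i] B0[of x i] B1[of x i]
      by auto
  qed
  have "0 \<in> diag_plane" by (simp add: diag_plane_def)
  then have "geom B \<noteq> {}"
    using g by (auto simp: homeomorphism_def)
  then obtain x i where "B (x, i) = 1" by (auto simp: geom_iff)
  then have "D \<noteq> {}" "D \<noteq> UNIV" using B1 by auto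
  with down eq that show thesis by blast
qed

section \<open>From a down-closed set back to a surface\<close>

definition cell_below :: "real ^ 'n::finite \<Rightarrow> int ^ 'n" where
  "cell_below s = (\<chi> k. \<lceil>s $ k\<rceil> - 1)"

text \<open>\<open>cell_below s\<close> and \<open>cell_above s\<close> are the lower corners of the
  cubes entered from \<open>s\<close> by a small step down or up the diagonal; they differ exactly
  in the integer coordinates of \<open>s\<close>.\<close>

definition cell_above :: "real ^ 'n::finite \<Rightarrow> int ^ 'n" where
  "cell_above s = (\<chi> k. \<lfloor>s $ k\<rfloor>)"

text \<open>At a point of the surface the diagonal passes from cubes in \<open>D\<close> to cubes
  outside. This turns injectivity and surjectivity of the projection into statements about diagonal
  lines.\<close>

lemma geom_coboundary:
  fixes D :: "(int ^ 'n::finite) set"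
  assumes "down_closed D"
  shows "s \<in> geom (coboundary (\<lambda>x. of_bool (x \<in> D))) \<longleftrightarrow> cell_below s \<in> D \<and> cell_above s \<notin> D"
proof -
  have "s \<in> geom (coboundary (\<lambda>x. of_bool (x \<in> D))) \<longleftrightarrow>
      (\<exists>x i. x \<in> D \<and> x + axis i 1 \<notin> D \<and> s \<in> facet x i)"
    by (simp add: geom_iff coboundary_down_closed[OF assms])
  also have "\<dots> \<longleftrightarrow> cell_below s \<in> D \<and> cell_above s \<notin> D"
  proof
    assume "\<exists>x i. x \<in> D \<and> x + axis i 1 \<notin> D \<and> s \<in> facet x i"
    then obtain x i where x: "x \<in> D" "x + axis i 1 \<notin> D" and s: "s \<in> facet x i" by blast
    have *: "(k = i \<longrightarrow> s $ k = of_int (x $ k) + 1) \<and>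
        (k \<noteq> i \<longrightarrow> of_int (x $ k) \<le> s $ k \<and> s $ k \<le> of_int (x $ k) + 1)" for k
      using s by (auto simp: facet_iff)
    have "s $ k \<le> of_int (x $ k) + 1" for k
      using *[of k] by (cases "k = i") auto
    then have "\<lceil>s $ k\<rceil> - 1 \<le> x $ k" for k
      by (metis ceiling_le diff_le_eq of_int_1 of_int_add)
    then have "cell_below s $ k \<le> x $ k" for k
      by (simp only: cell_below_def vec_lambda_beta)
    then have "cell_below s \<in> D"
      using down_closed_le[OF assms x(1)] by blast
    moreover have "(x + axis i 1) $ k \<le> cell_above s $ k" for k
      using *[of k] by (cases "k = i") (simp_all add: cell_above_def axis_def le_floor_iff)
    then have "cell_above s \<notin> D"
      using down_closed_le[OF assms] x(2) by blast
    ultimately show "cell_below s \<in> D \<and> cell_above s \<notin> D" ..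
  next
    assume s: "cell_below s \<in> D \<and> cell_above s \<notin> D"
    define P where "P A = (\<chi> k. if k \<in> A then \<lfloor>s $ k\<rfloor> else \<lceil>s $ k\<rceil> - 1)" for A
    have P0: "P {} = cell_below s" "P UNIV = cell_above s"
      by (simp_all add: P_def cell_below_def cell_above_def)
    \<comment> \<open>Raising the coordinates one by one from below to above, \<open>D\<close> is left at some step.\<close>
    have "P A \<in> D \<or> (\<exists>x i. x \<in> D \<and> x + axis i 1 \<notin> D \<and> s \<in> facet x i)" for A
      using finite[of A]
    proof (induction A rule: finite_induct)
      case empty
      then show ?case using s P0 by simp
    next
      case (insert i A)
      show ?case
      proof (cases "P A \<in> D \<and> P (insert i A) \<notin> D")
        case True
        \<comment> \<open>The step that leaves \<open>D\<close> really changes coordinate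
          \<open>i\<close>, which forces \<open>s $ i\<close> to be an integer and puts
          \<open>s\<close> on the facet crossed.\<close>
        have i: "\<lceil>s $ i\<rceil> - 1 \<noteq> \<lfloor>s $ i\<rfloor>"
        proof
          assume "\<lceil>s $ i\<rceil> - 1 = \<lfloor>s $ i\<rfloor>"
          then have "P (insert i A) = P A" by (auto simp: P_def vec_eq_iff)
          with True show False by simp
        qed
        then have si: "s $ i = of_int \<lfloor>s $ i\<rfloor>" "\<lceil>s $ i\<rceil> = \<lfloor>s $ i\<rfloor>"
          by linarith+
        have "P (insert i A) = P A + axis i 1"
          using insert.hyps(2) si by (auto simp: P_def vec_eq_iff axis_def)
        moreover have "s \<in> facet (P A) i"
          unfolding facet_iff using si insert.hyps(2)
          by (auto simp: P_def)
        ultimately show ?thesis using True by auto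
      qed (use insert.IH in blast)
    qed
    from this[of UNIV] show "\<exists>x i. x \<in> D \<and> x + axis i 1 \<notin> D \<and> s \<in> facet x i"
      using s P0 by simp
  qed
  finally show ?thesis .
qed

text \<open>With the left-hand version below: along a diagonal, \<open>cell_below\<close> is
  constant just before \<open>T\<close>, and just after \<open>T\<close> it equals
  \<open>cell_above\<close> at \<open>T\<close>.\<close>

lemma eventually_ceiling_at_right: "eventually (\<lambda>t. \<lceil>r + t\<rceil> - 1 = \<lfloor>r + T\<rfloor>) (at_right (T::real))"
proof -
  have "T < of_int (\<lfloor>r + T\<rfloor> + 1) - r" by linarith
  then show ?thesis
    unfolding eventually_at_right_field by (intro exI[of _ "of_int (\<lfloor>r + T\<rfloor> + 1) - r"]) (safe, linarith+)
qed

lemma eventually_ceiling_at_left: "eventually (\<lambda>t. \<lceil>r + t\<rceil> = \<lceil>r + T\<rceil>) (at_left (T::real))"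
proof -
  have "of_int (\<lceil>r + T\<rceil> - 1) - r < T" by linarith
  then show ?thesis
    unfolding eventually_at_left_field by (intro exI[of _ "of_int (\<lceil>r + T\<rceil> - 1) - r"]) (safe, linarith+)
qed

text \<open>The crossing parameter \<open>T\<close> is the supremum of the \<open>t\<close> with
  \<open>cell_below\<close> in \<open>D\<close>. Points of \<open>D\<close> and of its complement
  make this set nonempty and bounded, and the one-sided limits at \<open>T\<close> give the two
  claims.\<close>

lemma diagonal_meets_boundary:
  fixes D :: "(int ^ 'n::finite) set" and p :: "real ^ 'n"
  assumes down: "down_closed D" and "D \<noteq> {}" "D \<noteq> UNIV"
  obtains T where "cell_below (p + T *\<^sub>R 1) \<in> D" "cell_above (p + T *\<^sub>R 1) \<notin> D"
proof -
  obtain u v where u: "u \<in> D" and v: "v \<notin> D"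
    using assms by blast
  define S where "S = {t. cell_below (p + t *\<^sub>R 1) \<in> D}"
  have "Min (range (\<lambda>k. of_int (u $ k) - p $ k)) \<in> S"
  proof -
    have "Min (range (\<lambda>k. of_int (u $ k) - p $ k)) \<le> of_int (u $ k) - p $ k" for k
      by (rule Min_le) auto
    then have "cell_below (p + Min (range (\<lambda>k. of_int (u $ k) - p $ k)) *\<^sub>R 1) $ k \<le> u $ k" for k
      by (simp add: cell_below_def algebra_simps) (smt (verit) ceiling_le_iff)
    then show ?thesis
      unfolding S_def using down_closed_le[OF down u] by blast
  qed
  then have ne: "S \<noteq> {}" by blast
  have S_down: "t \<in> S" if "t' \<in> S" "t \<le> t'" for t t'
  proof -
    have "cell_below (p + t *\<^sub>R 1) $ k \<le> cell_below (p + t' *\<^sub>R 1) $ k" for k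
      using that ceiling_mono[of "p $ k + t" "p $ k + t'"]
      by (simp only: cell_below_def vec_lambda_beta) simp
    then show ?thesis
      using that down_closed_le[OF down] unfolding S_def by blast
  qed
  \<comment> \<open>From here on every coordinate is at least one above \<open>v\<close>; the extra
    one offsets the \<open>- 1\<close> in \<open>cell_below\<close>.\<close>
  define M where "M = Max (range (\<lambda>k. of_int (v $ k) + 1 - p $ k))"
  have "M \<notin> S"
  proof
    assume M: "M \<in> S"
    have "of_int (v $ k) + 1 - p $ k \<le> M" for k
      unfolding M_def by (rule Max_ge) auto
    then have "v $ k \<le> cell_below (p + M *\<^sub>R 1) $ k" for k
      by (simp add: cell_below_def algebra_simps) (smt (verit) le_ceiling_iff of_int_1 of_int_add)
    then show False
      using M v down_closed_le[OF down] unfolding S_def by blast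
  qed
  then have "t \<le> M" if "t \<in> S" for t
    using S_down[OF that, of M] by (meson linear)
  then have bdd: "bdd_above S" by (rule bdd_aboveI)
  define T where "T = Sup S"
  have "eventually (\<lambda>t. \<forall>k. \<lceil>p $ k + t\<rceil> = \<lceil>p $ k + T\<rceil>) (at_left T)"
    by (intro eventually_all_finite eventually_ceiling_at_left)
  then have "eventually (\<lambda>t. cell_below (p + t *\<^sub>R 1) = cell_below (p + T *\<^sub>R 1)) (at_left T)"
    by (rule eventually_mono) (simp add: cell_below_def)
  then obtain b where b: "b < T" "\<And>t. b < t \<Longrightarrow> t < T \<Longrightarrow> cell_below (p + t *\<^sub>R 1) = cell_below (p + T *\<^sub>R 1)"
    unfolding eventually_at_left_field by blast
  obtain t where t: "b < t" "t < T" using dense[OF b(1)] by blast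
  obtain t' where "t' \<in> S" "t < t'"
    using t(2) ne bdd unfolding T_def by (meson less_cSup_iff)
  then have "t \<in> S" using S_down by fastforce
  then have 1: "cell_below (p + T *\<^sub>R 1) \<in> D"
    using b(2)[OF t] by (simp add: S_def)
  have "eventually (\<lambda>t. \<forall>k. \<lceil>p $ k + t\<rceil> - 1 = \<lfloor>p $ k + T\<rfloor>) (at_right T)"
    by (intro eventually_all_finite eventually_ceiling_at_right)
  then have "eventually (\<lambda>t. cell_below (p + t *\<^sub>R 1) = cell_above (p + T *\<^sub>R 1)) (at_right T)"
    by (rule eventually_mono) (simp add: cell_below_def cell_above_def)
  then obtain c where c: "c > T" "\<And>t. T < t \<Longrightarrow> t < c \<Longrightarrow> cell_below (p + t *\<^sub>R 1) = cell_above (p + T *\<^sub>R 1)"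
    unfolding eventually_at_right_field by blast
  obtain r where r: "T < r" "r < c" using dense[OF c(1)] by blast
  then have "r \<notin> S"
    using cSup_upper[OF _ bdd, of r] unfolding T_def by fastforce
  then have 2: "cell_above (p + T *\<^sub>R 1) \<notin> D"
    using c(2)[OF r] by (simp add: S_def)
  from that 1 2 show thesis by blast
qed

text \<open>No surface point strictly exceeds another in all coordinates, so the surface is a
  Lipschitz graph over the diagonal plane and the inverse projection is continuous.\<close>

lemma coboundary_imp_stepped_surface:
  fixes D :: "(int ^ 'n::finite) set"
  assumes down: "down_closed D" and nontriv: "D \<noteq> {}" "D \<noteq> UNIV"
  shows "stepped_surface (coboundary (\<lambda>x. of_bool (x \<in> D)))"
proof -
  let ?B = "coboundary (\<lambda>x. of_bool (x \<in> D))"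
  let ?G = "geom ?B"
  note G = geom_coboundary[OF down]
  have bin: "binary ?B"
    by (auto simp: binary_def coboundary_down_closed[OF down])
  have not_less: "\<exists>k. s' $ k \<le> s $ k" if "s \<in> ?G" "s' \<in> ?G" for s s'
  proof (rule ccontr)
    assume "\<nexists>k. s' $ k \<le> s $ k"
    then have less: "s $ k < s' $ k" for k by (metis not_le)
    \<comment> \<open>A strict inequality in every coordinate leaves room between the two corners,
      so \<open>cell_below s' \<in> D\<close> would force
      \<open>cell_above s \<in> D\<close>.\<close>
    have "cell_above s $ k \<le> cell_below s' $ k" for k
      using less[of k] unfolding cell_above_def cell_below_def by simp linarith
    then show False
      using that down_closed_le[OF down] unfolding G by blast
  qed
  have height_le: "height s' - height s \<le> norm (diag_proj s' - diag_proj s)"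
    if st: "s \<in> ?G" "s' \<in> ?G" for s s'
  proof -
    obtain k where k: "s' $ k \<le> s $ k" using not_less st by blast
    have "\<bar>(diag_proj s' - diag_proj s) $ k\<bar> \<le> norm (diag_proj s' - diag_proj s)"
      by (rule component_le_norm_cart)
    \<comment> \<open>Since \<open>s' $ k \<le> s $ k\<close>, a gain in height must show up as a
      loss in coordinate \<open>k\<close> of the projection.\<close>
    moreover have "(diag_proj s' - diag_proj s) $ k = s' $ k - s $ k - (height s' - height s)"
      by (simp add: diag_proj_height)
    ultimately show ?thesis using k by linarith
  qed
  \<comment> \<open>The constant adds the displacement within the plane to the one along the
    all-ones vector.\<close>
  have lip: "dist s' s \<le> (1 + norm (1 :: real ^ 'n)) * dist (diag_proj s') (diag_proj s)"
    if st: "s \<in> ?G" "s' \<in> ?G" for s s'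
  proof -
    have h: "\<bar>height s' - height s\<bar> \<le> norm (diag_proj s' - diag_proj s)"
      using height_le[of s s'] height_le[of s' s] st by (simp add: norm_minus_commute)
    have "s' - s = (diag_proj s' - diag_proj s) + (height s' - height s) *\<^sub>R 1"
      by (simp add: diag_proj_height algebra_simps)
    then have "norm (s' - s) \<le> norm (diag_proj s' - diag_proj s) + \<bar>height s' - height s\<bar> * norm (1 :: real ^ 'n)"
      by (metis norm_scaleR norm_triangle_ineq)
    also have "\<dots> \<le> norm (diag_proj s' - diag_proj s) + norm (diag_proj s' - diag_proj s) * norm (1 :: real ^ 'n)"
      using h by (intro add_left_mono mult_right_mono) auto
    finally show ?thesis by (simp add: dist_norm algebra_simps)
  qed
  have inj: "inj_on diag_proj ?G"
    by (rule inj_onI) (use lip in fastforce)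
  have img: "diag_proj ` ?G = diag_plane"
  proof
    show "diag_plane \<subseteq> diag_proj ` ?G"
    proof
      fix p :: "real ^ 'n" assume p: "p \<in> diag_plane"
      obtain T where "cell_below (p + T *\<^sub>R 1) \<in> D" "cell_above (p + T *\<^sub>R 1) \<notin> D"
        by (rule diagonal_meets_boundary[OF down nontriv])
      then have "p + T *\<^sub>R 1 \<in> ?G" by (simp add: G)
      moreover have "diag_proj (p + T *\<^sub>R 1) = p"
        using p by (simp add: diag_proj_add_diag) (simp add: diag_proj_height height_diag_plane)
      ultimately show "p \<in> diag_proj ` ?G" by (metis imageI)
    qed
  qed (auto simp: diag_proj_in)
  define g where "g = the_inv_into ?G diag_proj"
  have g1: "g (diag_proj s) = s" if "s \<in> ?G" for s
    using the_inv_into_f_f[OF inj that] by (simp add: g_def)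
  have g2: "diag_proj (g p) = p" "g p \<in> ?G" if "p \<in> diag_plane" for p
    using that f_the_inv_into_f[OF inj] the_inv_into_into[OF inj] img by (auto simp: g_def)
  have "(1 + norm (1 :: real ^ 'n))-lipschitz_on diag_plane g"
  proof (rule lipschitz_onI)
    fix p q :: "real ^ 'n" assume "p \<in> diag_plane" "q \<in> diag_plane"
    then show "dist (g p) (g q) \<le> (1 + norm (1 :: real ^ 'n)) * dist p q"
      using lip[of "g q" "g p"] by (simp add: g2)
  qed simp
  then have "continuous_on diag_plane g" by (rule lipschitz_on_continuous_on)
  moreover have "g ` diag_plane = ?G"
  proof
    show "?G \<subseteq> g ` diag_plane"
      using image_eqI[where f = g, OF g1[symmetric] diag_proj_in] by (rule subsetI)
  qed (auto simp: g2)
  ultimately have "homeomorphism ?G diag_plane diag_proj g"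
    unfolding homeomorphism_def using g1 g2 img continuous_on_diag_proj by auto
  with bin show ?thesis unfolding stepped_surface_def by blast
qed

section \<open>Runs and inverse Brun substitutions\<close>

lemma face_row_le_iff:
  assumes "binary B"
  shows "face_row j i x I \<le> B \<longleftrightarrow> (\<forall>k\<in>I. B (x + k *s axis j 1, i) = 1)"
proof -
  have B: "B f \<le> 1" "0 \<le> B f" for f
    using rangeI[of B f] assms unfolding binary_def by fastforce+
  show ?thesis
  proof
    assume "face_row j i x I \<le> B"
    then have le: "face_row j i x I (x + k *s axis j 1, i) \<le> B (x + k *s axis j 1, i)" for k
      by (rule le_funD)
    show "\<forall>k\<in>I. B (x + k *s axis j 1, i) = 1"
    proof
      fix k assume "k \<in> I"
      then have "face_row j i x I (x + k *s axis j 1, i) = 1"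
        by (auto simp: face_row_def)
      then show "B (x + k *s axis j 1, i) = 1"
        using le[of k] B(1) by (intro antisym) simp_all
    qed
  next
    assume "\<forall>k\<in>I. B (x + k *s axis j 1, i) = 1"
    then show "face_row j i x I \<le> B"
      unfolding le_fun_def face_row_def by (auto intro: B(2))
  qed
qed

text \<open>Exhibits the maximal interval explicitly: the offsets \<open>k\<close> that are joined
  to 0 by present faces only, on either side of 0.\<close>

lemma run_through_face:
  assumes bin: "binary B" and ij: "i \<noteq> j" and x: "B (x, i) = 1"
  shows "is_run B j i x {k. \<forall>t\<in>{min 0 k..max 0 k}. B (x + t *s axis j 1, i) = 1}" (is "is_run B j i x ?I")
proof -
  have 0: "0 \<in> ?I" using x by simp
  have "int_interval ?I"
    unfolding int_interval_def
  proof (intro ballI subsetI)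
    fix a b k assume a: "a \<in> ?I" and b: "b \<in> ?I" and k: "k \<in> {a..b}"
    have "t \<in> {min 0 a..max 0 a} \<union> {min 0 b..max 0 b}" if "t \<in> {min 0 k..max 0 k}" for t
      using that k by auto
    then show "k \<in> ?I" using a b by blast
  qed
  moreover have "face_row j i x ?I \<noteq> (\<lambda>_. 0)"
  proof
    assume "face_row j i x ?I = (\<lambda>_. 0)"
    then have "face_row j i x ?I (x + 0 *s axis j 1, i) = 0" by (rule fun_cong)
    moreover have "\<exists>k\<in>?I. (x + 0 *s axis j 1, i) = (x + k *s axis j 1, i)"
      using refl 0 by (rule bexI)
    then have "face_row j i x ?I (x + 0 *s axis j 1, i) = 1"
      unfolding face_row_def by (rule if_P)
    ultimately show False by simp
  qed
  moreover have "face_row j i x ?I \<le> B"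
    unfolding face_row_le_iff[OF bin] by auto
  moreover have "I' = ?I" if I': "int_interval I'" "?I \<subseteq> I'" "face_row j i x I' \<le> B" for I'
  proof
    show "I' \<subseteq> ?I"
    proof
      fix k assume "k \<in> I'"
      moreover have "0 \<in> I'" using 0 I' by blast
      ultimately have "{min 0 k..max 0 k} \<subseteq> I'"
        using I'(1) unfolding int_interval_def by (metis max_def min_def)
      then show "k \<in> ?I"
        using I'(3) unfolding face_row_le_iff[OF bin] by blast
    qed
  qed (use I' in blast)
  ultimately show ?thesis
    unfolding is_run_def using ij by blast
qed

text \<open>Condition (1) of a Brun pair with \<open>k = j\<close>: the \<open>(e_i, j)\<close>-run
  through the first face would contain the offsets 0 and 1.\<close>

lemma no_adjacent_faces:
  assumes "binary B" "brun_pair B i j" "B (x, j) = 1" "B (x + axis i 1, j) = 1"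
  shows False
proof -
  let ?I = "{k. \<forall>t\<in>{min 0 k..max 0 k}. B (x + t *s axis i 1, j) = 1}"
  have ij: "i \<noteq> j" using assms by (simp add: brun_pair_def)
  then have "is_run B i j x ?I"
    using run_through_face[OF assms(1) _ assms(3), of i] by simp
  moreover have "card I = 1" if "is_run B i j x I" for I
    using assms(2) ij that unfolding brun_pair_def by metis
  ultimately have "card ?I = 1" by blast
  moreover have "B (x + t *s axis i 1, j) = 1" if "t \<in> {0..1}" for t
    using that assms(3,4) by (cases "t = 0") (auto dest: antisym)
  then have "0 \<in> ?I" "1 \<in> ?I" using assms(3) by auto
  moreover have "is_singleton ?I \<Longrightarrow> 0 \<in> ?I \<Longrightarrow> 1 \<in> ?I \<Longrightarrow> (0::int) = 1"
    unfolding is_singleton_def by (elim exE) (simp only: singleton_iff)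
  ultimately show False
    by (simp only: is_singleton_altdef) simp
qed

lemma shortest_run_le:
  assumes "is_run B j i x I" "finite I"
  shows "shortest_run B j i \<le> card I"
  unfolding shortest_run_def using assms by (intro Least_le) blast

text \<open>A line in direction \<open>e_j\<close> meets a down-closed set in an initial part;
  \<open>m\<close> is one less than the first natural step that leaves it.\<close>

lemma down_closed_max:
  fixes D :: "(int ^ 'n::finite) set"
  assumes "down_closed D" "z \<in> D" "z + int a *s axis j 1 \<notin> D"
  obtains m where "m < a" "\<And>t. z + t *s axis j 1 \<in> D \<longleftrightarrow> t \<le> int m"
proof -
  have mono: "z + t *s axis j 1 \<in> D" if "z + t' *s axis j 1 \<in> D" "t \<le> t'" for t t'
    by (rule down_closed_le[OF assms(1) that(1)]) (use that(2) in \<open>auto simp: axis_def\<close>)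
  define n where "n = (LEAST n. z + int n *s axis j 1 \<notin> D)"
  have n: "z + int n *s axis j 1 \<notin> D"
    unfolding n_def using assms(3) by (rule LeastI)
  have "n \<noteq> 0" using n assms(2) by (auto intro: ccontr)
  have "n \<le> a" unfolding n_def using assms(3) by (rule Least_le)
  have "z + int (n - 1) *s axis j 1 \<in> D"
    using not_less_Least[of "n - 1" "\<lambda>n. z + int n *s axis j 1 \<notin> D"] \<open>n \<noteq> 0\<close> by (simp add: n_def)
  then have "z + t *s axis j 1 \<in> D \<longleftrightarrow> t \<le> int (n - 1)" for t
    using mono[of "int (n - 1)" t] mono[of t "int n"] n \<open>n \<noteq> 0\<close> by fastforce
  then show thesis using that[of "n - 1"] \<open>n \<noteq> 0\<close> \<open>n \<le> a\<close> by simp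
qed

text \<open>Otherwise the \<open>e_j\<close>-lines from \<open>z\<close> and
  \<open>z + axis i 1\<close> leave \<open>D\<close> after steps \<open>m\<close> and
  \<open>n\<close>, both smaller than the shortest run length, with \<open>n \<le> m\<close>. The
  cases \<open>n = m\<close> and \<open>n < m\<close> contradict the two run conditions.\<close>

lemma brun_pair_exchange:
  fixes D :: "(int ^ 'n::finite) set"
  defines "B \<equiv> coboundary (\<lambda>x. of_bool (x \<in> D))"
  assumes down: "down_closed D" and pair: "brun_pair B i j"
    and z: "z + axis i 1 \<in> D"
  shows "z + int (shortest_run B j i) *s axis j 1 \<in> D"
proof (rule ccontr)
  let ?a = "shortest_run B j i"
  assume out: "z + int ?a *s axis j 1 \<notin> D"
  have ij: "i \<noteq> j" using pair by (simp add: brun_pair_def)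
  have B: "B (x, k) = of_bool (x \<in> D \<and> x + axis k 1 \<notin> D)" for x k
    unfolding B_def by (rule coboundary_down_closed[OF down])
  have bin: "binary B" by (auto simp: binary_def B)
  have "z \<in> D" using z down by (auto simp: down_closed_def)
  then obtain m where m: "m < ?a" "\<And>t. z + t *s axis j 1 \<in> D \<longleftrightarrow> t \<le> int m"
    using down_closed_max[OF down _ out] by blast
  have "z + axis i 1 + int ?a *s axis j 1 \<notin> D"
    using out down by (metis (no_types, lifting) add.assoc add.commute down_closed_def)
  then obtain n where n: "n < ?a" "\<And>t. z + axis i 1 + t *s axis j 1 \<in> D \<longleftrightarrow> t \<le> int n"
    using down_closed_max[OF down z] by blast
  have n': "z + t *s axis j 1 + axis i 1 \<in> D \<longleftrightarrow> t \<le> int n" for t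
    using n(2)[of t] by (simp add: add_ac)
  have succ: "z + t *s axis j 1 + axis j 1 = z + (t + 1) *s axis j 1" for t
    by (simp add: vec_eq_iff algebra_simps)
  have "n \<le> m"
    using n'[of "int n"] m(2)[of "int n"] down by (auto simp: down_closed_def)
  moreover have "n \<noteq> m"
  proof
    assume "n = m"
    define x where "x = z + int m *s axis j 1"
    have "B (x, j) = 1"
      unfolding x_def B succ m(2) by simp
    moreover have "x + axis i 1 + axis j 1 = z + (int m + 1) *s axis j 1 + axis i 1"
      by (simp add: x_def vec_eq_iff algebra_simps)
    then have "B (x + axis i 1, j) = 1"
      using \<open>n = m\<close> unfolding B by (simp only: x_def n') simp
    ultimately show False using no_adjacent_faces[OF bin pair] by blast
  qed
  ultimately have nm: "n < m" by simp
  \<comment> \<open>The last point of the first line in \<open>D\<close>. The faces of type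
    \<open>i\<close> on this line sit exactly at steps \<open>n + 1\<close> to \<open>m\<close>, a
    finite run of length \<open>m - n\<close>.\<close>
  define x where "x = z + int m *s axis j 1"
  have shift: "x + t *s axis j 1 = z + (int m + t) *s axis j 1" for t
    by (simp add: x_def vec_eq_iff algebra_simps)
  have faces: "B (x + t *s axis j 1, i) = 1 \<longleftrightarrow> t \<le> 0 \<and> int n - int m < t" for t
    unfolding shift B m(2) n' by auto
  let ?I = "{k. \<forall>t\<in>{min 0 k..max 0 k}. B (x + t *s axis j 1, i) = 1}"
  have "?I = {int n - int m <.. 0}"
  proof
    show "?I \<subseteq> {int n - int m <.. 0}"
    proof
      fix k assume "k \<in> ?I"
      then have "B (x + k *s axis j 1, i) = 1" by simp
      then show "k \<in> {int n - int m <.. 0}" by (simp add: faces)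
    qed
  qed (auto simp: faces)
  moreover have "B (x, i) = 1" using faces[of 0] nm by simp
  then have "is_run B j i x ?I" by (rule run_through_face[OF bin ij])
  ultimately have "?a \<le> m - n"
    using shortest_run_le[of B j i x ?I] by simp
  then show False using m(1) nm by simp
qed

section \<open>The incidence matrix of the inverse Brun substitution\<close>

lemma incidence_brun_inv:
  assumes "i \<noteq> j"
  shows "incidence_matrix (brun_inv a i j) *v axis k 1 =
    (if k = i then axis j 1 else if k = j then axis i 1 - int a *s axis j 1 else axis k 1)"
proof -
  have "exp_vec (replicate a (Neg j)) = - (int a *s axis j 1)"
    by (induction a) (auto simp: vec_eq_iff algebra_simps)
  then show ?thesis
    by (simp add: incidence_matrix_axis brun_inv_Pos[OF assms])
qed

text \<open>Ensures that the preimage of \<open>D\<close> is again neither empty nor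
  everything.\<close>

lemma surj_incidence_brun_inv:
  fixes i j :: "'n::finite"
  assumes ij: "i \<noteq> j"
  shows "surj (\<lambda>x. incidence_matrix (brun_inv a i j) *v x)"
proof (rule surjI)
  let ?M = "incidence_matrix (brun_inv a i j)"
  fix y :: "int ^ 'n"
  \<comment> \<open>The columns of the incidence matrix of the Brun substitution itself, which give
    a right inverse.\<close>
  define v where "v k = (if k = j then axis i 1 else if k = i then axis j 1 + int a *s axis i 1 else axis k 1)"
    for k :: 'n
  have v: "?M *v v k = axis k 1" for k
    using ij by (simp add: v_def incidence_brun_inv matrix_vector_right_distrib matrix_vector_mult_smult_int)
  have "?M *v (\<Sum>k\<in>A. y $ k *s v k) = (\<Sum>k\<in>A. y $ k *s axis k 1)" for A :: "'n set"
    using finite[of A]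
    by (induction A rule: finite_induct)
      (simp_all add: matrix_vector_right_distrib matrix_vector_mult_smult_int v)
  then show "?M *v (\<Sum>k\<in>UNIV. y $ k *s v k) = y"
    by (simp add: vec_eq_iff axis_def if_distrib cong: if_cong)
qed

lemma stepped_surface_dual_map_brun_inv:
  fixes B :: "'n::finite stepped"
  assumes "stepped_surface B" and pair: "brun_pair B i j"
  shows "stepped_surface (dual_map (brun_inv (shortest_run B j i) i j) B)"
proof -
  obtain D where down: "down_closed D" and D: "D \<noteq> {}" "D \<noteq> UNIV"
    and B: "B = coboundary (\<lambda>x. of_bool (x \<in> D))"
    using stepped_surface_imp_coboundary[OF assms(1)] by blast
  have ij: "i \<noteq> j" using pair by (simp add: brun_pair_def)
  define a where "a = shortest_run B j i"
  let ?M = "incidence_matrix (brun_inv a i j)"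
  let ?D = "{x. ?M *v x \<in> D}"
  have "down_closed ?D"
    unfolding down_closed_def
  proof (intro allI impI)
    fix x k assume "x + axis k 1 \<in> ?D"
    then have x: "?M *v x + ?M *v axis k 1 \<in> D"
      by (simp add: matrix_vector_right_distrib)
    show "x \<in> ?D"
    proof (cases "k = j")
      case True
      \<comment> \<open>Column \<open>j\<close> is \<open>axis i 1 - int a *s axis j 1\<close>, so
        the images of \<open>x + axis j 1\<close> and \<open>x\<close> are
        \<open>z + axis i 1\<close> and \<open>z + int a *s axis j 1\<close>, as in the exchange
        property. All other columns are unit vectors.\<close>
      define z where "z = ?M *v x - int a *s axis j 1"
      have "z + axis i 1 \<in> D"
        using x True ij by (simp add: incidence_brun_inv z_def algebra_simps)
      then have "z + int a *s axis j 1 \<in> D"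
        using brun_pair_exchange[OF down] pair unfolding a_def B by blast
      then show ?thesis by (simp add: z_def)
    next
      case False
      then obtain l where "?M *v axis k 1 = axis l 1"
        using incidence_brun_inv[OF ij, of a k] by metis
      then show ?thesis
        using x down unfolding down_closed_def mem_Collect_eq by metis
    qed
  qed
  moreover have "?D \<noteq> {}" "?D \<noteq> UNIV"
  proof -
    obtain u v where "?M *v u \<in> D" "?M *v v \<notin> D"
      using D surj_incidence_brun_inv[OF ij, of a] by (metis all_not_in_conv UNIV_eq_I surjD)
    then show "?D \<noteq> {}" "?D \<noteq> UNIV" by auto
  qed
  ultimately show ?thesis
    using coboundary_imp_stepped_surface[of ?D] unfolding a_def B dual_map_coboundary by simp
qed

theorem theorem5p9:
  fixes B :: "'n::{finite,linorder} stepped"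
  assumes "CARD('n) \<ge> 3"
    and "stepped_surface B"
  shows "stepped_surface (T_tilde B)"
proof (cases "\<exists>i j. brun_pair B i j")
  case True
  \<comment> \<open>In a finite linear order a nonempty set has a minimum, so \<open>LEAST\<close>
    is attained.\<close>
  have Least: "P (LEAST k. P k)" if "\<exists>k. P k" for P :: "'n \<Rightarrow> bool"
    using Least_Min[of P] Min_in[of "{k. P k}"] that by auto
  define i where "i = (LEAST i. \<exists>j. brun_pair B i j)"
  define j where "j = (LEAST j. brun_pair B i j)"
  have "\<exists>j. brun_pair B i j"
    using Least[of "\<lambda>i. \<exists>j. brun_pair B i j"] True unfolding i_def by blast
  then have "brun_pair B i j"
    using Least[of "brun_pair B i"] unfolding j_def by blast
  then have "stepped_surface (dual_map (brun_inv (shortest_run B j i) i j) B)"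
    using assms(2) by (intro stepped_surface_dual_map_brun_inv)
  moreover have "T_tilde B = dual_map (brun_inv (shortest_run B j i) i j) B"
    unfolding T_tilde_def Let_def i_def j_def using True by (rule if_P)
  ultimately show ?thesis by simp
next
  case False
  then have "T_tilde B = B" unfolding T_tilde_def by (rule if_not_P)
  then show ?thesis using assms(2) by simp
qed

end
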